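(* Let $k$ be a field and let $C$ be a semiperfect coalgebra over $k$. Then $C$ is co-Frobenius if and only if there exists a non-degenerate bilinear form $B:C\times C\to k$ which is $C^*$-balanced.
   Context: Let $C$ be a coalgebra over a field $k$, with comultiplication $\Delta(x)=\sum x_1\otimes x_2$. The dual $C^*=\mathrm{Hom}_k(C,k)$ is an algebra with the convolution product $(c^*d^* )(x)=\sum c^*(x_1)d^*(x_2)$. $C$ is a $(C^*,C^* )$-bimodule with actions $c^*\cdot x=\sum c^*(x_2)x_1$ and $x\cdot c^*=\sum c^*(x_1)x_2$; $C^*$ is a $(C^*,C^* )$-bimodule by multiplication. $C$ is right (respectively left) semiperfect if the category of right (respectively left) $C$-comodules has enough projectives, equivalently if the injective envelope of every simple left (respectively right) $C$-comodule is finite dimensional. $C$ is semiperfect if it is both left and right semiperfect. $C$ is left (respectively right) co-Frobenius if there exists an injective morphism of left (respectively right) $C^*$-modules $C\to C^*$. $C$ is co-Frobenius if it is both left and right co-Frobenius. A bilinear form $B:C\times C\to k$ is $C^*$-balanced if $B(x\cdot c^*,y)=B(x,c^*\cdot y)$ for all $x,y\in C$, $c^*\in C^*$. It is non-degenerate if $B(C,y)=0$ implies $y=0$ and $B(y,C)=0$ implies $y=0$. *)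

theory Defs
  imports Complex_Main "HOL-Library.Multiset" "HOL-Library.Function_Algebras"
begin

section \<open>Tensor products of vector spaces\<close>

text \<open>
  An element of \<open>V \<otimes> W\<close> is a finite sum of pure tensors \<open>v \<otimes> w\<close>; it is represented by a multiset
  of pairs, a formal sum. Two formal sums denote the same tensor iff they are related by
  \<open>tensor_eq\<close>, the least congruence on formal sums that contains the bilinearity relations. Thus
  \<open>V \<otimes> W\<close> is the set of formal sums over \<open>V \<times> W\<close> modulo \<open>tensor_eq\<close>. The quotient is a group without
  adjoining formal negatives, since \<open>(- v, w) + (v, w)\<close> is identified with \<open>(0, w)\<close>, hence with \<open>0\<close>.
  The spaces \<open>V\<close>, \<open>W\<close> are subspaces of ambient types, and only their own elements enter the
  relations. A map into \<open>V \<otimes> W\<close> is given by a choice of representatives, so all equations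
  between tensors are stated up to \<open>tensor_eq\<close>.
\<close>

inductive tensor_eq ::
  "('k \<Rightarrow> 'v::ab_group_add \<Rightarrow> 'v) \<Rightarrow> 'v set \<Rightarrow> ('k \<Rightarrow> 'w::ab_group_add \<Rightarrow> 'w) \<Rightarrow> 'w set
    \<Rightarrow> ('v \<times> 'w) multiset \<Rightarrow> ('v \<times> 'w) multiset \<Rightarrow> bool"
  for sV V sW W
where
  refl: "tensor_eq sV V sW W t t"
| sym: "tensor_eq sV V sW W t u \<Longrightarrow> tensor_eq sV V sW W u t"
| trans: "tensor_eq sV V sW W t u \<Longrightarrow> tensor_eq sV V sW W u v \<Longrightarrow> tensor_eq sV V sW W t v"
| cong: "tensor_eq sV V sW W t u \<Longrightarrow> tensor_eq sV V sW W t' u'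
    \<Longrightarrow> tensor_eq sV V sW W (t + t') (u + u')"
| zero: "y \<in> W \<Longrightarrow> tensor_eq sV V sW W {#(0, y)#} {#}"
| add_left: "x \<in> V \<Longrightarrow> x' \<in> V \<Longrightarrow> y \<in> W
    \<Longrightarrow> tensor_eq sV V sW W {#(x + x', y)#} {#(x, y), (x', y)#}"
| add_right: "x \<in> V \<Longrightarrow> y \<in> W \<Longrightarrow> y' \<in> W
    \<Longrightarrow> tensor_eq sV V sW W {#(x, y + y')#} {#(x, y), (x, y')#}"
| scale: "x \<in> V \<Longrightarrow> y \<in> W \<Longrightarrow> tensor_eq sV V sW W {#(sV a x, y)#} {#(x, sW a y)#}"

text \<open>The same for \<open>U \<otimes> V \<otimes> W\<close>.\<close>

inductive tensor3_eq ::
  "('k \<Rightarrow> 'u::ab_group_add \<Rightarrow> 'u) \<Rightarrow> 'u set \<Rightarrow> ('k \<Rightarrow> 'v::ab_group_add \<Rightarrow> 'v) \<Rightarrow> 'v set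
    \<Rightarrow> ('k \<Rightarrow> 'w::ab_group_add \<Rightarrow> 'w) \<Rightarrow> 'w set
    \<Rightarrow> ('u \<times> 'v \<times> 'w) multiset \<Rightarrow> ('u \<times> 'v \<times> 'w) multiset \<Rightarrow> bool"
  for sU U sV V sW W
where
  refl: "tensor3_eq sU U sV V sW W t t"
| sym: "tensor3_eq sU U sV V sW W t u \<Longrightarrow> tensor3_eq sU U sV V sW W u t"
| trans: "tensor3_eq sU U sV V sW W t u \<Longrightarrow> tensor3_eq sU U sV V sW W u v
    \<Longrightarrow> tensor3_eq sU U sV V sW W t v"
| cong: "tensor3_eq sU U sV V sW W t u \<Longrightarrow> tensor3_eq sU U sV V sW W t' u'
    \<Longrightarrow> tensor3_eq sU U sV V sW W (t + t') (u + u')"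
| zero: "y \<in> V \<Longrightarrow> z \<in> W \<Longrightarrow> tensor3_eq sU U sV V sW W {#(0, y, z)#} {#}"
| add1: "x \<in> U \<Longrightarrow> x' \<in> U \<Longrightarrow> y \<in> V \<Longrightarrow> z \<in> W
    \<Longrightarrow> tensor3_eq sU U sV V sW W {#(x + x', y, z)#} {#(x, y, z), (x', y, z)#}"
| add2: "x \<in> U \<Longrightarrow> y \<in> V \<Longrightarrow> y' \<in> V \<Longrightarrow> z \<in> W
    \<Longrightarrow> tensor3_eq sU U sV V sW W {#(x, y + y', z)#} {#(x, y, z), (x, y', z)#}"
| add3: "x \<in> U \<Longrightarrow> y \<in> V \<Longrightarrow> z \<in> W \<Longrightarrow> z' \<in> W
    \<Longrightarrow> tensor3_eq sU U sV V sW W {#(x, y, z + z')#} {#(x, y, z), (x, y, z')#}"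
| scale12: "x \<in> U \<Longrightarrow> y \<in> V \<Longrightarrow> z \<in> W
    \<Longrightarrow> tensor3_eq sU U sV V sW W {#(sU a x, y, z)#} {#(x, sV a y, z)#}"
| scale23: "x \<in> U \<Longrightarrow> y \<in> V \<Longrightarrow> z \<in> W
    \<Longrightarrow> tensor3_eq sU U sV V sW W {#(x, sV a y, z)#} {#(x, y, sW a z)#}"

definition map_tensor :: "('a \<Rightarrow> 'c) \<Rightarrow> ('b \<Rightarrow> 'd) \<Rightarrow> ('a \<times> 'b) multiset \<Rightarrow> ('c \<times> 'd) multiset" where
  "map_tensor f g t = image_mset (\<lambda>(x, y). (f x, g y)) t"

definition apply_left :: "('a \<Rightarrow> ('p \<times> 'q) multiset) \<Rightarrow> ('a \<times> 'b) multiset \<Rightarrow> ('p \<times> 'q \<times> 'b) multiset"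
  where \<comment> \<open>\<open>f \<otimes> id\<close> for a map \<open>f\<close> into a tensor product\<close>
  "apply_left f t = (\<Sum>(x, y)\<in>#t. image_mset (\<lambda>(p, q). (p, q, y)) (f x))"

definition apply_right :: "('b \<Rightarrow> ('p \<times> 'q) multiset) \<Rightarrow> ('a \<times> 'b) multiset \<Rightarrow> ('a \<times> 'p \<times> 'q) multiset"
  where \<comment> \<open>\<open>id \<otimes> f\<close>\<close>
  "apply_right f t = (\<Sum>(x, y)\<in>#t. image_mset (\<lambda>(p, q). (x, p, q)) (f y))"


section \<open>Enough projectives\<close>

text \<open>
  For concrete abelian categories whose objects are pairs of a carrier and a structure on it and
  whose epimorphisms are the surjective morphisms, as is the case for comodules over a coalgebra over a field.
  A morphism is a function on the ambient type, of which only the values on the source carrier matter.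
\<close>

definition projective_object ::
  "('m set \<times> 's \<Rightarrow> bool) \<Rightarrow> ('m set \<times> 's \<Rightarrow> 'm set \<times> 's \<Rightarrow> ('m \<Rightarrow> 'm) \<Rightarrow> bool) \<Rightarrow> 'm set \<times> 's \<Rightarrow> bool"
where
  "projective_object obj hom P \<longleftrightarrow> obj P \<and>
    (\<forall>X Y g f. obj X \<and> obj Y \<and> hom X Y g \<and> g ` fst X = fst Y \<and> hom P Y f \<longrightarrow>
      (\<exists>h. hom P X h \<and> (\<forall>p\<in>fst P. g (h p) = f p)))"

definition enough_projectives ::
  "('m set \<times> 's \<Rightarrow> bool) \<Rightarrow> ('m set \<times> 's \<Rightarrow> 'm set \<times> 's \<Rightarrow> ('m \<Rightarrow> 'm) \<Rightarrow> bool) \<Rightarrow> bool"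
where
  "enough_projectives obj hom \<longleftrightarrow>
    (\<forall>M. obj M \<longrightarrow> (\<exists>P g. projective_object obj hom P \<and> hom P M g \<and> g ` fst P = fst M))"

definition fun_scale :: "'k::times \<Rightarrow> ('i \<Rightarrow> 'k) \<Rightarrow> 'i \<Rightarrow> 'k" where
  "fun_scale a f = (\<lambda>i. a * f i)"

lemma vector_space_fun_scale: "vector_space (fun_scale :: 'k::field \<Rightarrow> ('i \<Rightarrow> 'k) \<Rightarrow> 'i \<Rightarrow> 'k)"
  by unfold_locales (auto simp: fun_scale_def fun_eq_iff algebra_simps)

definition linear_on ::
  "('k \<Rightarrow> 'm \<Rightarrow> 'm) \<Rightarrow> ('k \<Rightarrow> 'n \<Rightarrow> 'n) \<Rightarrow> 'm::ab_group_add set \<Rightarrow> 'n::ab_group_add set \<Rightarrow> ('m \<Rightarrow> 'n) \<Rightarrow> bool"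
where
  "linear_on sM sN M N f \<longleftrightarrow> (\<forall>x\<in>M. f x \<in> N) \<and>
    (\<forall>x\<in>M. \<forall>y\<in>M. f (x + y) = f x + f y) \<and> (\<forall>a. \<forall>x\<in>M. f (sM a x) = sN a (f x))"


section \<open>Coalgebras\<close>

locale coalgebra = vector_space scale
  for scale :: "'k::field \<Rightarrow> 'c::ab_group_add \<Rightarrow> 'c" (infixr \<open>*s\<close> 75) +
  fixes \<Delta> :: "'c \<Rightarrow> ('c \<times> 'c) multiset" and \<epsilon> :: "'c \<Rightarrow> 'k"
  assumes comult_add: "tensor_eq scale UNIV scale UNIV (\<Delta> (x + y)) (\<Delta> x + \<Delta> y)"
    and comult_scale: "tensor_eq scale UNIV scale UNIV (\<Delta> (a *s x)) (map_tensor (scale a) id (\<Delta> x))"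
    and counit_linear: "Vector_Spaces.linear scale (*) \<epsilon>"
    and coassoc: "tensor3_eq scale UNIV scale UNIV scale UNIV
          (apply_left \<Delta> (\<Delta> x)) (apply_right \<Delta> (\<Delta> x))"
    and counit_left: "(\<Sum>(x1, x2)\<in>#\<Delta> x. \<epsilon> x1 *s x2) = x"
    and counit_right: "(\<Sum>(x1, x2)\<in>#\<Delta> x. \<epsilon> x2 *s x1) = x"
begin

definition right_comodule ::
  "('k \<Rightarrow> 'm::ab_group_add \<Rightarrow> 'm) \<Rightarrow> 'm set \<times> ('m \<Rightarrow> ('m \<times> 'c) multiset) \<Rightarrow> bool"
where
  "right_comodule sM = (\<lambda>(M, \<rho>). vector_space sM \<and> module.subspace sM M \<and>
    (\<forall>x\<in>M. set_mset (\<rho> x) \<subseteq> M \<times> UNIV) \<and>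
    (\<forall>x\<in>M. \<forall>y\<in>M. tensor_eq sM M scale UNIV (\<rho> (x + y)) (\<rho> x + \<rho> y)) \<and>
    (\<forall>a. \<forall>x\<in>M. tensor_eq sM M scale UNIV (\<rho> (sM a x)) (map_tensor (sM a) id (\<rho> x))) \<and>
    (\<forall>x\<in>M. tensor3_eq sM M scale UNIV scale UNIV (apply_left \<rho> (\<rho> x)) (apply_right \<Delta> (\<rho> x))) \<and>
    (\<forall>x\<in>M. (\<Sum>(m, c)\<in>#\<rho> x. sM (\<epsilon> c) m) = x))"

definition right_comodule_hom ::
  "('k \<Rightarrow> 'm \<Rightarrow> 'm) \<Rightarrow> ('k \<Rightarrow> 'n \<Rightarrow> 'n)
    \<Rightarrow> 'm::ab_group_add set \<times> ('m \<Rightarrow> ('m \<times> 'c) multiset)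
    \<Rightarrow> 'n::ab_group_add set \<times> ('n \<Rightarrow> ('n \<times> 'c) multiset) \<Rightarrow> ('m \<Rightarrow> 'n) \<Rightarrow> bool"
where
  "right_comodule_hom sM sN = (\<lambda>(M, \<rho>) (N, \<sigma>) f. linear_on sM sN M N f \<and>
    (\<forall>x\<in>M. tensor_eq sN N scale UNIV (\<sigma> (f x)) (map_tensor f id (\<rho> x))))"

definition left_comodule ::
  "('k \<Rightarrow> 'm::ab_group_add \<Rightarrow> 'm) \<Rightarrow> 'm set \<times> ('m \<Rightarrow> ('c \<times> 'm) multiset) \<Rightarrow> bool"
where
  "left_comodule sM = (\<lambda>(M, \<rho>). vector_space sM \<and> module.subspace sM M \<and>
    (\<forall>x\<in>M. set_mset (\<rho> x) \<subseteq> UNIV \<times> M) \<and>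
    (\<forall>x\<in>M. \<forall>y\<in>M. tensor_eq scale UNIV sM M (\<rho> (x + y)) (\<rho> x + \<rho> y)) \<and>
    (\<forall>a. \<forall>x\<in>M. tensor_eq scale UNIV sM M (\<rho> (sM a x)) (map_tensor id (sM a) (\<rho> x))) \<and>
    (\<forall>x\<in>M. tensor3_eq scale UNIV scale UNIV sM M (apply_left \<Delta> (\<rho> x)) (apply_right \<rho> (\<rho> x))) \<and>
    (\<forall>x\<in>M. (\<Sum>(c, m)\<in>#\<rho> x. sM (\<epsilon> c) m) = x))"

definition left_comodule_hom ::
  "('k \<Rightarrow> 'm \<Rightarrow> 'm) \<Rightarrow> ('k \<Rightarrow> 'n \<Rightarrow> 'n)
    \<Rightarrow> 'm::ab_group_add set \<times> ('m \<Rightarrow> ('c \<times> 'm) multiset)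
    \<Rightarrow> 'n::ab_group_add set \<times> ('n \<Rightarrow> ('c \<times> 'n) multiset) \<Rightarrow> ('m \<Rightarrow> 'n) \<Rightarrow> bool"
where
  "left_comodule_hom sM sN = (\<lambda>(M, \<rho>) (N, \<sigma>) f. linear_on sM sN M N f \<and>
    (\<forall>x\<in>M. tensor_eq scale UNIV sN N (\<sigma> (f x)) (map_tensor id f (\<rho> x))))"

text \<open>
  The category of comodules has to be formed inside a universe. We take the comodules whose
  underlying space is a subspace of \<open>k\<^sup>I\<close> with \<open>I = 'u \<times> 'c \<times> nat\<close>, where \<open>'u\<close> is an arbitrary type: up
  to isomorphism these are all comodules of dimension at most \<open>dim k\<^sup>I\<close>. The factor \<open>'u\<close> makes the
  universe as large as desired; the factor \<open>'c \<times> nat\<close> makes it infinite and at least as large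
  as \<open>C\<close>. Since comodules are unions of their finite dimensional subcomodules, every such universe has
  enough projectives iff the category of all comodules does.
\<close>

definition right_semiperfect :: "'u itself \<Rightarrow> bool" where
  "right_semiperfect (_ :: 'u itself) \<longleftrightarrow>
    enough_projectives (right_comodule (fun_scale :: 'k \<Rightarrow> ('u \<times> 'c \<times> nat \<Rightarrow> 'k) \<Rightarrow> _))
      (right_comodule_hom fun_scale fun_scale)"

definition left_semiperfect :: "'u itself \<Rightarrow> bool" where
  "left_semiperfect (_ :: 'u itself) \<longleftrightarrow>
    enough_projectives (left_comodule (fun_scale :: 'k \<Rightarrow> ('u \<times> 'c \<times> nat \<Rightarrow> 'k) \<Rightarrow> _))
      (left_comodule_hom fun_scale fun_scale)"

definition semiperfect :: "'u itself \<Rightarrow> bool" where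
  "semiperfect u \<longleftrightarrow> left_semiperfect u \<and> right_semiperfect u"

definition dual :: "('c \<Rightarrow> 'k) set" where
  "dual = {f. Vector_Spaces.linear scale (*) f}"

definition convolution :: "('c \<Rightarrow> 'k) \<Rightarrow> ('c \<Rightarrow> 'k) \<Rightarrow> 'c \<Rightarrow> 'k" where
  "convolution f g x = (\<Sum>(x1, x2)\<in>#\<Delta> x. f x1 * g x2)"

definition left_action :: "('c \<Rightarrow> 'k) \<Rightarrow> 'c \<Rightarrow> 'c" where
  "left_action f x = (\<Sum>(x1, x2)\<in>#\<Delta> x. f x2 *s x1)"

definition right_action :: "'c \<Rightarrow> ('c \<Rightarrow> 'k) \<Rightarrow> 'c" where
  "right_action x f = (\<Sum>(x1, x2)\<in>#\<Delta> x. f x1 *s x2)"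

definition left_dual_module_hom :: "('c \<Rightarrow> 'c \<Rightarrow> 'k) \<Rightarrow> bool" where
  "left_dual_module_hom \<phi> \<longleftrightarrow> (\<forall>x. \<phi> x \<in> dual) \<and> (\<forall>x y. \<phi> (x + y) = \<phi> x + \<phi> y) \<and>
    (\<forall>f\<in>dual. \<forall>x. \<phi> (left_action f x) = convolution f (\<phi> x))"

definition right_dual_module_hom :: "('c \<Rightarrow> 'c \<Rightarrow> 'k) \<Rightarrow> bool" where
  "right_dual_module_hom \<phi> \<longleftrightarrow> (\<forall>x. \<phi> x \<in> dual) \<and> (\<forall>x y. \<phi> (x + y) = \<phi> x + \<phi> y) \<and>
    (\<forall>f\<in>dual. \<forall>x. \<phi> (right_action x f) = convolution (\<phi> x) f)"

definition left_co_frobenius :: bool where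
  "left_co_frobenius \<longleftrightarrow> (\<exists>\<phi>. left_dual_module_hom \<phi> \<and> inj \<phi>)"

definition right_co_frobenius :: bool where
  "right_co_frobenius \<longleftrightarrow> (\<exists>\<phi>. right_dual_module_hom \<phi> \<and> inj \<phi>)"

definition co_frobenius :: bool where
  "co_frobenius \<longleftrightarrow> left_co_frobenius \<and> right_co_frobenius"

definition bilinear_form :: "('c \<Rightarrow> 'c \<Rightarrow> 'k) \<Rightarrow> bool" where
  "bilinear_form B \<longleftrightarrow> (\<forall>x. Vector_Spaces.linear scale (*) (\<lambda>y. B x y)) \<and>
    (\<forall>y. Vector_Spaces.linear scale (*) (\<lambda>x. B x y))"

definition balanced :: "('c \<Rightarrow> 'c \<Rightarrow> 'k) \<Rightarrow> bool" where
  "balanced B \<longleftrightarrow> (\<forall>x y. \<forall>f\<in>dual. B (right_action x f) y = B x (left_action f y))"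

definition nondegenerate :: "('c \<Rightarrow> 'c \<Rightarrow> 'k) \<Rightarrow> bool" where
  "nondegenerate B \<longleftrightarrow> (\<forall>y. (\<forall>x. B x y = 0) \<longrightarrow> y = 0) \<and> (\<forall>y. (\<forall>x. B y x = 0) \<longrightarrow> y = 0)"

lemma right_comodule_self: "right_comodule scale (UNIV, \<Delta>)"
  using comult_add comult_scale coassoc counit_right vector_space_axioms
  by (auto simp: right_comodule_def)

end

end

theory Submission
  imports Defs
begin

text \<open>
  The form \<open>B\<close> and the module maps are the same data. A balanced form gives the left module map
  \<open>y \<mapsto> B(-, y)\<close> and the right module map \<open>x \<mapsto> B(x, -)\<close> from \<open>C\<close> to \<open>C\<^sup>*\<close>, and each of them determines
  the form. The first is injective iff \<open>B(C, y) = 0\<close> forces \<open>y = 0\<close>, the second iff \<open>B(x, C) = 0\<close> forces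
  \<open>x = 0\<close>. So a non-degenerate balanced form makes \<open>C\<close> co-Frobenius at once. Conversely, a co-Frobenius
  coalgebra provides two balanced forms, each known to be non-degenerate on one side, and these have to
  be merged into one form.

  Let \<open>\<phi>\<close> be an injective left and \<open>\<psi>\<close> an injective right module map \<open>C \<rightarrow> C\<^sup>*\<close>, and let \<open>\<psi>'\<close> be the left
  module map \<open>\<psi>'(y)(x) = \<psi>(x)(y)\<close>. Since \<open>\<psi>\<close> is injective, \<open>\<epsilon>\<close> extends along it to a linear functional
  \<open>\<Lambda>\<close> with \<open>\<Lambda>(\<psi>(x)) = \<epsilon>(x)\<close>. For every left module map \<open>\<chi> : C \<rightarrow> C\<^sup>*\<close> the endomorphism
  \<open>s\<^sub>\<chi>(y) = y \<cdot> (\<Lambda> \<circ> \<chi>)\<close> of the left module \<open>C\<close> satisfies \<open>\<psi>' \<circ> s\<^sub>\<chi> = \<chi>\<close>, because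
  \<open>\<psi>(x)(s\<^sub>\<chi>(y)) = \<Lambda>(\<psi>(x) \<chi>(y)) = \<Lambda>(\<psi>(x \<cdot> \<chi>(y))) = \<epsilon>(x \<cdot> \<chi>(y)) = \<chi>(y)(x)\<close>.
  So every left module map factors through \<open>\<psi>'\<close>. For \<open>\<chi> = \<psi>'\<close> the result is an idempotent \<open>e\<close> with the
  same kernel as \<open>\<psi>'\<close>; for \<open>\<chi> = \<phi>\<close> it is an injective \<open>f\<close> with image inside \<open>e(C)\<close>. Hence \<open>C\<close> embeds into its own
  direct summand \<open>e(C)\<close>, and a Cantor-Bernstein argument for injective objects (due to Bumby) yields
  an isomorphism \<open>\<theta> : C \<rightarrow> e(C)\<close>. The form \<open>B(x, y) = \<psi>(x)(\<theta>(y))\<close> is balanced; it is non-degenerate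
  in \<open>y\<close> because \<open>\<psi>'\<close> is injective on \<open>e(C)\<close>, and in \<open>x\<close> because \<open>\<psi>' \<circ> e = \<psi>'\<close> and \<open>\<psi>\<close> is injective.

  The Cantor-Bernstein argument (\<open>summand_iso_if_embeds\<close>) splits off \<open>P = X \<oplus> f(X) \<oplus> f\<^sup>2(X) \<oplus> \<dots>\<close> with
  \<open>X = ker e\<close> and uses \<open>f\<close> on \<open>P\<close> and the identity on a complement. That \<open>P\<close> has a complement is the
  content of \<open>increasing_summands_complement\<close>: in \<open>C\<close> an increasing union of direct summands is a direct
  summand, since every element generates a finite dimensional submodule. The other ingredient is
  that \<open>C\<close> is an injective comodule, which here takes the concrete form that a linear functional \<open>\<mu>\<close>
  induces the module endomorphism \<open>y \<mapsto> y \<cdot> \<mu>\<close>, and that this map is the identity on a submodule where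
  \<open>\<mu> = \<epsilon>\<close> and zero on a submodule where \<open>\<mu> = 0\<close>.
\<close>

section \<open>Linear algebra\<close>

text \<open>
  Elements of a tensor product enter only through the values of multilinear maps on them; these two
  lemmas make such values independent of the representing formal sum.
\<close>

lemma tensor_eq_eval:
  fixes \<beta> :: "'v::ab_group_add \<Rightarrow> 'w::ab_group_add \<Rightarrow> 'z::ab_group_add"
  assumes "tensor_eq sV V sW W t u"
    and addl: "\<And>x x' y. \<beta> (x + x') y = \<beta> x y + \<beta> x' y"
    and addr: "\<And>x y y'. \<beta> x (y + y') = \<beta> x y + \<beta> x y'"
    and sc: "\<And>a x y. \<beta> (sV a x) y = \<beta> x (sW a y)"
  shows "(\<Sum>(x, y)\<in>#t. \<beta> x y) = (\<Sum>(x, y)\<in>#u. \<beta> x y)"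
  using assms(1)
proof induction
  case (zero y)
  have "\<beta> 0 y = 0" using addl[of 0 0 y] by simp
  then show ?case by simp
qed (simp_all add: addl addr sc)

lemma tensor3_eq_eval:
  fixes \<beta> :: "'u::ab_group_add \<Rightarrow> 'v::ab_group_add \<Rightarrow> 'w::ab_group_add \<Rightarrow> 'z::ab_group_add"
  assumes "tensor3_eq sU U sV V sW W t u"
    and add1: "\<And>x x' y z. \<beta> (x + x') y z = \<beta> x y z + \<beta> x' y z"
    and add2: "\<And>x y y' z. \<beta> x (y + y') z = \<beta> x y z + \<beta> x y' z"
    and add3: "\<And>x y z z'. \<beta> x y (z + z') = \<beta> x y z + \<beta> x y z'"
    and sc12: "\<And>a x y z. \<beta> (sU a x) y z = \<beta> x (sV a y) z"
    and sc23: "\<And>a x y z. \<beta> x (sV a y) z = \<beta> x y (sW a z)"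
  shows "(\<Sum>(x, y, z)\<in>#t. \<beta> x y z) = (\<Sum>(x, y, z)\<in>#u. \<beta> x y z)"
  using assms(1)
proof induction
  case (zero y z)
  have "\<beta> 0 y z = 0" using add1[of 0 0 y z] by simp
  then show ?case by simp
qed (simp_all add: add1 add2 add3 sc12 sc23)

text \<open>
  A finite basis of \<open>V\<close> is already contained in one member of the chain.
\<close>

lemma (in vector_space) finite_span_chain:
  fixes W :: "nat \<Rightarrow> 'b set"
  assumes S: "finite S" and V: "subspace V" "V \<subseteq> span S" "V \<subseteq> (\<Union>n. W n)"
    and W: "\<And>n. subspace (W n)" "\<And>n. W n \<subseteq> W (Suc n)"
  shows "\<exists>m. V \<subseteq> W m"
proof -
  obtain B where B: "B \<subseteq> V" "independent B" "V \<subseteq> span B"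
    using basis_exists by metis
  have fin: "finite B" using independent_span_bound[OF S B(2)] B(1) V(2) by auto
  have mono: "W i \<subseteq> W j" if "i \<le> j" for i j
    using lift_Suc_mono_le[where f = W, OF W(2) that] .
  have "\<exists>n. b \<in> W n" if "b \<in> B" for b using that B(1) V(3) by blast
  then obtain n where n: "\<And>b. b \<in> B \<Longrightarrow> b \<in> W (n b)" by metis
  have "B \<subseteq> W (Max (n ` B))"
  proof
    fix b assume "b \<in> B"
    then have "n b \<le> Max (n ` B)" using fin by simp
    then show "b \<in> W (Max (n ` B))" using n[OF \<open>b \<in> B\<close>] mono by blast
  qed
  then show ?thesis using B(3) span_minimal[OF _ W(1)] by blast
qed

section \<open>The dual algebra and its actions\<close>

context coalgebra
begin

lemma dualD:
  assumes "f \<in> dual"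
  shows "f (x + y) = f x + f y" "f (a *s x) = a * f x" "f 0 = 0" "f (x - y) = f x - f y"
    "f (sum_mset (image_mset g M)) = (\<Sum>i\<in>#M. f (g i))"
proof -
  interpret l: Vector_Spaces.linear scale "(*)" f using assms by (simp add: dual_def)
  show "f (x + y) = f x + f y" "f (a *s x) = a * f x" "f 0 = 0" "f (x - y) = f x - f y"
    by (simp_all add: l.add l.scale l.zero l.diff)
  show "f (sum_mset (image_mset g M)) = (\<Sum>i\<in>#M. f (g i))"
    by (induction M) (simp_all add: l.add l.zero)
qed

lemma dualI:
  assumes "\<And>x y. f (x + y) = f x + f y" "\<And>a x. f (a *s x) = a * f x"
  shows "f \<in> dual"
  unfolding dual_def mem_Collect_eq by unfold_locales (simp_all add: assms algebra_simps)

lemma zero_dual: "(\<lambda>_. 0) \<in> dual"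
  by (rule dualI) simp_all

lemma counit_dual: "\<epsilon> \<in> dual"
  using counit_linear by (simp add: dual_def)

text \<open>
  This turns every identity in \<open>C\<close> into one in the dual algebra: below, equations between elements
  are proved by pairing both sides with all functionals.
\<close>

lemma dual_separates:
  assumes "\<And>f. f \<in> dual \<Longrightarrow> f x = f y"
  shows "x = y"
proof (rule ccontr)
  interpret vp: vector_space_pair scale "(*) :: 'k \<Rightarrow> 'k \<Rightarrow> 'k"
    by unfold_locales (simp_all add: algebra_simps)
  assume "x \<noteq> y"
  then have "independent {x - y}" by simp
  from vp.linear_independent_extend[OF this, of "\<lambda>_. 1"]
  obtain g where "Vector_Spaces.linear scale (*) g" "g (x - y) = 1" by auto
  then have "g \<in> dual" "g (x - y) = 1" by (auto simp: dual_def)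
  then show False using assms[of g] by (simp add: dualD)
qed

lemma left_action_pairing: "h \<in> dual \<Longrightarrow> h (left_action f x) = convolution h f x"
  by (simp add: left_action_def convolution_def dualD case_prod_unfold mult.commute)

lemma right_action_pairing: "h \<in> dual \<Longrightarrow> h (right_action x f) = convolution f h x"
  by (simp add: right_action_def convolution_def dualD case_prod_unfold)

lemma convolution_dual:
  assumes "f \<in> dual" "g \<in> dual"
  shows "convolution f g \<in> dual"
proof (rule dualI)
  fix x y :: 'c and a :: 'k
  have "convolution f g (x + y) = (\<Sum>(p, q)\<in>#\<Delta> x + \<Delta> y. f p * g q)"
    unfolding convolution_def
    by (rule tensor_eq_eval[where \<beta> = "\<lambda>p q. f p * g q", OF comult_add]) (simp_all add: dualD assms algebra_simps)
  then show "convolution f g (x + y) = convolution f g x + convolution f g y"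
    by (simp add: convolution_def)
  have "convolution f g (a *s x) = (\<Sum>(p, q)\<in>#map_tensor (scale a) id (\<Delta> x). f p * g q)"
    unfolding convolution_def
    by (rule tensor_eq_eval[where \<beta> = "\<lambda>p q. f p * g q", OF comult_scale]) (simp_all add: dualD assms algebra_simps)
  then show "convolution f g (a *s x) = a * convolution f g x"
    by (simp add: convolution_def map_tensor_def multiset.map_comp comp_def case_prod_unfold
        dualD assms sum_mset_distrib_left mult.assoc)
qed

lemma convolution_assoc:
  assumes "f \<in> dual" "g \<in> dual" "h \<in> dual"
  shows "convolution (convolution f g) h = convolution f (convolution g h)"
proof
  fix x
  have "(\<Sum>(p, q, r)\<in>#apply_left \<Delta> (\<Delta> x). f p * g q * h r) =
    (\<Sum>(p, q, r)\<in>#apply_right \<Delta> (\<Delta> x). f p * g q * h r)"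
    by (rule tensor3_eq_eval[where \<beta> = "\<lambda>p q r. f p * g q * h r", OF coassoc]) (simp_all add: dualD assms algebra_simps)
  moreover have "(\<Sum>(p, q, r)\<in>#apply_left \<Delta> T. f p * g q * h r) =
      (\<Sum>(p, q)\<in>#T. convolution f g p * h q)" for T
    by (induction T) (auto simp: apply_left_def convolution_def multiset.map_comp comp_def
        case_prod_unfold sum_mset_distrib_right)
  moreover have "(\<Sum>(p, q, r)\<in>#apply_right \<Delta> T. f p * g q * h r) =
      (\<Sum>(p, q)\<in>#T. f p * convolution g h q)" for T
    by (induction T) (auto simp: apply_right_def convolution_def multiset.map_comp comp_def
        case_prod_unfold sum_mset_distrib_left mult.assoc)
  ultimately show "convolution (convolution f g) h x = convolution f (convolution g h) x"
    by (simp add: convolution_def[of _ _ x])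
qed

lemma left_action_counit: "left_action \<epsilon> x = x"
  using counit_right by (simp add: left_action_def)

text \<open>
  Scalar multiplication is the action of a multiple of the unit \<open>\<epsilon>\<close> of the dual algebra. Additive maps
  and subsets compatible with the action are therefore automatically compatible with scalars.
\<close>

lemma left_action_scaled_counit: "left_action (\<lambda>x. a * \<epsilon> x) x = a *s x"
proof -
  have "a *s sum_mset (image_mset g M) = (\<Sum>i\<in>#M. a *s g i)" for g :: "'c \<times> 'c \<Rightarrow> 'c" and M
    by (induction M) (simp_all add: scale_right_distrib)
  from this[of "\<lambda>(p, q). \<epsilon> q *s p" "\<Delta> x"] show ?thesis
    using counit_right[of x] by (simp add: left_action_def case_prod_unfold)
qed

lemma scaled_counit_dual: "(\<lambda>x. a * \<epsilon> x) \<in> dual"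
  by (rule dualI) (simp_all add: dualD counit_dual algebra_simps)

lemma convolution_counit:
  assumes "f \<in> dual"
  shows "convolution f \<epsilon> = f" "convolution \<epsilon> f = f"
proof -
  have "right_action x \<epsilon> = x" for x using counit_left by (simp add: right_action_def)
  then show "convolution f \<epsilon> = f" "convolution \<epsilon> f = f"
    using left_action_pairing[OF assms, of \<epsilon>] right_action_pairing[OF assms, of _ \<epsilon>]
    by (auto simp: left_action_counit)
qed

lemma convolution_scaled_counit:
  assumes "f \<in> dual"
  shows "convolution (\<lambda>x. a * \<epsilon> x) f = fun_scale a f"
proof
  fix x
  have "convolution (\<lambda>x. a * \<epsilon> x) f x = a * convolution \<epsilon> f x"
    by (simp add: convolution_def sum_mset_distrib_left case_prod_unfold mult.assoc)
  then show "convolution (\<lambda>x. a * \<epsilon> x) f x = fun_scale a f x"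
    by (simp add: convolution_counit assms fun_scale_def)
qed

lemma left_action_left_action:
  assumes "f \<in> dual" "g \<in> dual"
  shows "left_action f (left_action g x) = left_action (convolution f g) x"
  by (rule dual_separates)
    (simp add: left_action_pairing convolution_dual convolution_assoc assms)

lemma left_action_right_action:
  assumes "f \<in> dual" "u \<in> dual"
  shows "left_action f (right_action x u) = right_action (left_action f x) u"
  by (rule dual_separates)
    (simp add: left_action_pairing right_action_pairing convolution_dual convolution_assoc assms)

lemma left_action_linear:
  assumes "f \<in> dual"
  shows "left_action f (x + y) = left_action f x + left_action f y"
    "left_action f (x - y) = left_action f x - left_action f y"
    "left_action f 0 = 0"
  by (rule dual_separates; simp add: left_action_pairing dualD dualD[OF convolution_dual] assms)+

lemma left_action_add_fun: "left_action (\<lambda>x. f x + g x) x = left_action f x + left_action g x"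
  by (simp add: left_action_def case_prod_unfold scale_left_distrib sum_mset.distrib)

lemma left_action_zero: "left_action (\<lambda>_. 0) x = 0"
  by (simp add: left_action_def case_prod_unfold)

text \<open>
  The submodule generated by \<open>x\<close> is finite dimensional: it lies in the span of the first
  tensor factors of any representative of \<open>\<Delta> x\<close>.
\<close>

lemma left_action_in_span: "left_action f x \<in> span (fst ` set_mset (\<Delta> x))"
proof -
  have "(\<Sum>(p, q)\<in>#T. f q *s p) \<in> span (fst ` S)" if "set_mset T \<subseteq> S" for T and S :: "('c \<times> 'c) set"
    using that
  proof (induction T)
    case (add x T)
    have "f (snd x) *s fst x \<in> span (fst ` S)" using add.prems by (intro span_scale span_base) auto
    then show ?case using add by (simp add: case_prod_unfold span_add)
  qed (simp add: span_zero)
  then show ?thesis by (simp add: left_action_def)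
qed

section \<open>Submodules and endomorphisms\<close>

definition left_endomorphism :: "('c \<Rightarrow> 'c) \<Rightarrow> bool" where
  "left_endomorphism p \<longleftrightarrow> (\<forall>x y. p (x + y) = p x + p y) \<and>
    (\<forall>f\<in>dual. \<forall>x. p (left_action f x) = left_action f (p x))"

definition left_submodule :: "'c set \<Rightarrow> bool" where
  "left_submodule Q \<longleftrightarrow> 0 \<in> Q \<and> (\<forall>x\<in>Q. \<forall>y\<in>Q. x + y \<in> Q) \<and>
    (\<forall>f\<in>dual. \<forall>x\<in>Q. left_action f x \<in> Q)"

lemma left_submodule_subspace: "left_submodule Q \<Longrightarrow> subspace Q"
  unfolding subspace_def left_submodule_def
  by (metis left_action_scaled_counit scaled_counit_dual)

lemma left_endomorphismD:
  assumes "left_endomorphism p"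
  shows "p (x + y) = p x + p y" "f \<in> dual \<Longrightarrow> p (left_action f x) = left_action f (p x)"
    "p (a *s x) = a *s p x" "p 0 = 0" "p (x - y) = p x - p y"
proof -
  show add: "p (x + y) = p x + p y" for x y using assms by (simp add: left_endomorphism_def)
  show act: "f \<in> dual \<Longrightarrow> p (left_action f x) = left_action f (p x)" for f x
    using assms by (simp add: left_endomorphism_def)
  show "p (a *s x) = a *s p x"
    using act[OF scaled_counit_dual[of a], of x] by (simp add: left_action_scaled_counit)
  show "p 0 = 0" using add[of 0 0] by simp
  show "p (x - y) = p x - p y" using add[of "x - y" y] by (simp add: algebra_simps)
qed

text \<open>
  This is how linear functionals yield module maps: the functional \<open>u\<close> is recovered from the
  endomorphism by composition with \<open>\<epsilon>\<close>.
\<close>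

lemma right_action_endomorphism:
  assumes "u \<in> dual"
  shows "left_endomorphism (\<lambda>x. right_action x u)"
proof -
  have "right_action (x + y) u = right_action x u + right_action y u" for x y
    by (rule dual_separates)
      (simp add: right_action_pairing dualD dualD[OF convolution_dual] assms)
  then show ?thesis by (simp add: left_endomorphism_def left_action_right_action assms)
qed

lemma left_submodule_fixed:
  assumes "left_endomorphism p"
  shows "left_submodule {x. p x = x}"
  using assms by (simp add: left_submodule_def left_endomorphismD)

lemma right_action_functional:
  assumes "u \<in> dual" "h \<in> dual"
  shows "h (right_action y u) = u (left_action h y)"
  by (simp add: assms left_action_pairing right_action_pairing)

lemma dual_linear_comp:
  assumes "u \<in> dual" "\<And>x y. g (x + y) = g x + g y" "\<And>a x. g (a *s x) = a *s g x"
  shows "(\<lambda>x. u (g x)) \<in> dual"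
  by (rule dualI) (simp_all add: assms dualD)

lemma left_submodule_chain_Union:
  assumes "K \<noteq> {}" "\<And>U. U \<in> K \<Longrightarrow> left_submodule U"
    and chain: "\<And>U V. U \<in> K \<Longrightarrow> V \<in> K \<Longrightarrow> U \<subseteq> V \<or> V \<subseteq> U"
  shows "left_submodule (\<Union>K)"
proof -
  have "x + y \<in> \<Union>K" if "x \<in> \<Union>K" "y \<in> \<Union>K" for x y
  proof -
    from that obtain U V where UV: "U \<in> K" "x \<in> U" "V \<in> K" "y \<in> V" by blast
    then show ?thesis using chain[of U V] assms(2)[of U] assms(2)[of V]
      unfolding left_submodule_def by blast
  qed
  then show ?thesis using assms(1,2) unfolding left_submodule_def by blast
qed

lemma left_submoduleD:
  assumes "left_submodule Q"
  shows "0 \<in> Q" "x \<in> Q \<Longrightarrow> y \<in> Q \<Longrightarrow> x + y \<in> Q"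
    "h \<in> dual \<Longrightarrow> x \<in> Q \<Longrightarrow> left_action h x \<in> Q"
  using assms by (auto simp: left_submodule_def)

lemma left_submodule_sum:
  assumes M: "left_submodule M" and N: "left_submodule N"
  shows "left_submodule {x + y | x y. x \<in> M \<and> y \<in> N}" (is "left_submodule ?S")
proof -
  have I: "x + y \<in> ?S" if "x \<in> M" "y \<in> N" for x y using that by blast
  have "0 \<in> ?S" using I[OF left_submoduleD(1)[OF M] left_submoduleD(1)[OF N]] by simp
  moreover have "u + v \<in> ?S" if uv: "u \<in> ?S" "v \<in> ?S" for u v
  proof -
    from uv obtain x y x' y' where "u = x + y" "x \<in> M" "y \<in> N" "v = x' + y'" "x' \<in> M" "y' \<in> N"
      by blast
    then show ?thesis
      using I[of "x + x'" "y + y'"] left_submoduleD(2)[OF M, of x x'] left_submoduleD(2)[OF N, of y y']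
      by (simp only: add.assoc add.left_commute)
  qed
  moreover have "left_action h u \<in> ?S" if h: "h \<in> dual" and u: "u \<in> ?S" for h u
  proof -
    from u obtain x y where "u = x + y" "x \<in> M" "y \<in> N" by blast
    then show ?thesis
      using I[OF left_submoduleD(3)[OF M h] left_submoduleD(3)[OF N h]]
      by (simp only: left_action_linear(1)[OF h])
  qed
  ultimately show ?thesis unfolding left_submodule_def by blast
qed

lemma left_submodule_cyclic: "left_submodule {left_action h x | h. h \<in> dual}"
  unfolding left_submodule_def
proof (intro conjI ballI)
  show "0 \<in> {left_action h x | h. h \<in> dual}"
    using zero_dual left_action_zero[of x] by force
next
  fix u v assume "u \<in> {left_action h x | h. h \<in> dual}" "v \<in> {left_action h x | h. h \<in> dual}"
  then obtain h k where "h \<in> dual" "k \<in> dual" "u = left_action h x" "v = left_action k x" by blast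
  moreover from this have "(\<lambda>x. h x + k x) \<in> dual"
    by (intro dualI) (simp_all add: dualD algebra_simps)
  ultimately show "u + v \<in> {left_action h x | h. h \<in> dual}"
    using left_action_add_fun[of h k x] by force
next
  fix h u assume "h \<in> dual" "u \<in> {left_action h x | h. h \<in> dual}"
  then show "left_action h u \<in> {left_action h x | h. h \<in> dual}"
    using left_action_left_action convolution_dual by fastforce
qed

section \<open>Direct summands\<close>

text \<open>
  The projection is \<open>p(x \<cdot> \<mu>)\<close> for a functional \<open>\<mu>\<close> that agrees with \<open>\<epsilon>\<close> on the summand \<open>p(C)\<close> and
  vanishes on \<open>Q\<close>. Such a \<open>\<mu>\<close> exists because \<open>p(C)\<close> and \<open>Q\<close> are linearly disjoint.
\<close>

lemma summand_projection_along:
  assumes p: "left_endomorphism p" "\<And>x. p (p x) = p x"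
    and Q: "left_submodule Q" "\<And>x. x \<in> Q \<Longrightarrow> p x = x \<Longrightarrow> x = 0"
  shows "\<exists>r. left_endomorphism r \<and> (\<forall>x. p (r x) = r x) \<and> (\<forall>x. p x = x \<longrightarrow> r x = x) \<and>
    (\<forall>x\<in>Q. r x = 0)"
proof -
  interpret vp: vector_space_pair scale scale ..
  note pD = left_endomorphismD[OF p(1)]
  let ?d = "\<lambda>x. x - p x"
  have lin: "Vector_Spaces.linear scale scale ?d"
    by unfold_locales (simp_all add: pD algebra_simps)
  have inj: "inj_on ?d Q"
  proof (rule inj_onI)
    fix x y assume xy: "x \<in> Q" "y \<in> Q" "x - p x = y - p y"
    have "x - y \<in> Q" using left_submodule_subspace[OF Q(1)] xy by (simp add: subspace_diff)
    moreover have "p (x - y) = x - y" using xy(3) by (simp add: pD algebra_simps)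
    ultimately show "x = y" using Q(2) by force
  qed
  obtain \<gamma> where \<gamma>: "Vector_Spaces.linear scale scale \<gamma>" "\<And>x. x \<in> Q \<Longrightarrow> \<gamma> (x - p x) = x"
    using vp.linear_exists_left_inverse_on[OF lin left_submodule_subspace[OF Q(1)] inj] by auto
  interpret \<gamma>: Vector_Spaces.linear scale scale \<gamma> by fact
  \<comment> \<open>\<open>x \<mapsto> p (x - \<gamma> (x - p x))\<close> is a linear projection onto \<open>p(C)\<close> that kills \<open>Q\<close>, as \<open>\<gamma>\<close> recovers \<open>x \<in> Q\<close> from \<open>x - p x\<close>.\<close>
  define \<mu> where "\<mu> x = \<epsilon> (p (x - \<gamma> (x - p x)))" for x
  have \<mu>: "\<mu> \<in> dual" unfolding \<mu>_def
    by (rule dualI) (simp_all add: pD \<gamma>.add \<gamma>.diff \<gamma>.scale dualD[OF counit_dual] algebra_simps)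
  define r where "r x = p (right_action x \<mu>)" for x
  have "left_endomorphism r"
    using left_endomorphismD(1,2)[OF right_action_endomorphism[OF \<mu>]] pD(1,2)
    by (simp add: left_endomorphism_def r_def)
  moreover have "p (r x) = r x" for x by (simp add: r_def p)
  moreover have "r x = x" if "p x = x" for x
  proof -
    have "right_action x \<mu> = x"
    proof (rule dual_separates)
      fix h assume h: "h \<in> dual"
      have "p (left_action h x) = left_action h x" using that by (simp add: pD h)
      then have "\<mu> (left_action h x) = \<epsilon> (left_action h x)" by (simp add: \<mu>_def \<gamma>.zero)
      then show "h (right_action x \<mu>) = h x"
        by (simp add: right_action_functional \<mu> h left_action_pairing counit_dual convolution_counit)
    qed
    then show ?thesis using that by (simp add: r_def)
  qed
  moreover have "r x = 0" if "x \<in> Q" for x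
  proof -
    have "right_action x \<mu> = 0"
    proof (rule dual_separates)
      fix h assume h: "h \<in> dual"
      have "left_action h x \<in> Q" using that h Q(1) by (simp add: left_submodule_def)
      then have "\<mu> (left_action h x) = 0" by (simp add: \<mu>_def \<gamma> pD dualD counit_dual)
      then show "h (right_action x \<mu>) = h 0"
        by (simp add: right_action_functional \<mu> h dualD)
    qed
    then show ?thesis by (simp add: r_def pD)
  qed
  ultimately show ?thesis by blast
qed

lemma maximal_disjoint_submodule:
  assumes "0 \<notin> D"
  obtains Q where "left_submodule Q" "Q \<inter> D = {}"
    "\<And>Q'. left_submodule Q' \<Longrightarrow> Q' \<inter> D = {} \<Longrightarrow> Q \<subseteq> Q' \<Longrightarrow> Q' = Q"
proof -
  let ?A = "{Q. left_submodule Q \<and> Q \<inter> D = {}}"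
  have "\<exists>Q\<in>?A. \<forall>Q'\<in>?A. Q \<subseteq> Q' \<longrightarrow> Q' = Q"
  proof (rule subset_Zorn_nonempty)
    have "{0} \<in> ?A" using assms by (simp add: left_submodule_def left_action_linear)
    then show "?A \<noteq> {}" by blast
    fix K assume K: "K \<noteq> {}" "subset.chain ?A K"
    have "left_submodule (\<Union>K)"
      by (rule left_submodule_chain_Union) (use K in \<open>auto simp: subset_chain_def\<close>)
    then show "\<Union>K \<in> ?A" using K(2) by (auto simp: subset_chain_def)
  qed
  then obtain Q where Q: "Q \<in> ?A" "\<forall>Q'\<in>?A. Q \<subseteq> Q' \<longrightarrow> Q' = Q" by (rule bexE)
  show ?thesis by (rule that[of Q]) (use Q in simp_all)
qed

text \<open>
  Let \<open>P\<close> be the union of the summands \<open>p\<^sub>n(C)\<close> and let \<open>Q\<close> be a maximal submodule with \<open>Q \<inter> P = 0\<close>. Let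
  \<open>x \<in> C\<close> and let \<open>N\<close> be the submodule generated by \<open>x\<close>. It is finite dimensional, so
  \<open>N \<inter> (P + Q) \<subseteq> p\<^sub>m(C) + Q\<close> for some \<open>m\<close>. With a projection \<open>r\<close> of \<open>C\<close> onto \<open>p\<^sub>m(C)\<close> along \<open>Q\<close>, the
  submodule \<open>Q + (1 - r)(N)\<close> still meets \<open>P\<close> trivially: an element \<open>q + n - r n\<close> of \<open>P\<close> has
  \<open>n \<in> P + Q\<close>, hence \<open>n = a + b\<close> with \<open>a \<in> p\<^sub>m(C)\<close> and \<open>b \<in> Q\<close>, so \<open>r n = a\<close> and the element is
  \<open>q + b \<in> Q \<inter> P\<close>. By maximality \<open>x - r x \<in> Q\<close>, so \<open>x \<in> P + Q\<close>.
\<close>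

lemma increasing_summands_complement:
  fixes p :: "nat \<Rightarrow> 'c \<Rightarrow> 'c"
  assumes p: "\<And>n. left_endomorphism (p n)" "\<And>n x. p n (p n x) = p n x"
    and inc: "\<And>n x. p n x = x \<Longrightarrow> p (Suc n) x = x"
  defines "P \<equiv> (\<Union>n. {a. p n a = a})"
  obtains Q where "left_submodule Q" "Q \<inter> P \<subseteq> {0}" "\<And>x. \<exists>a\<in>P. x - a \<in> Q"
proof -
  obtain Q where Q: "left_submodule Q" "Q \<inter> (P - {0}) = {}"
    and max: "\<And>Q'. left_submodule Q' \<Longrightarrow> Q' \<inter> (P - {0}) = {} \<Longrightarrow> Q \<subseteq> Q' \<Longrightarrow> Q' = Q"
    using maximal_disjoint_submodule[of "P - {0}"] by auto
  have disj: "x = 0" if "x \<in> Q" "x \<in> P" for x using Q(2) that by blast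
  note subsp = left_submodule_subspace[OF Q(1)]
  have "\<exists>a\<in>P. x - a \<in> Q" for x
  proof -
    define W where "W n = {a + q | a q. a \<in> {a. p n a = a} \<and> q \<in> Q}" for n
    have W: "left_submodule (W n)" for n
      unfolding W_def by (rule left_submodule_sum[OF left_submodule_fixed[OF p(1)] Q(1)])
    have incW: "W n \<subseteq> W (Suc n)" for n using inc by (fastforce simp: W_def)
    have W_mono: "W i \<subseteq> W j" if "i \<le> j" for i j
      using lift_Suc_mono_le[where f = W, OF incW that] .
    have "left_submodule (\<Union>n. W n)"
    proof (rule left_submodule_chain_Union)
      fix U V assume "U \<in> range W" "V \<in> range W"
      then show "U \<subseteq> V \<or> V \<subseteq> U" using W_mono by (metis imageE nat_le_linear)
    qed (use W in auto)
    note Wsub = left_submodule_subspace[OF this]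
    \<comment> \<open>A finite dimensional space that contains the part in \<open>P + Q\<close> of the submodule generated by \<open>x\<close>.\<close>
    let ?V = "span (fst ` set_mset (\<Delta> x)) \<inter> (\<Union>n. W n)"
    have "subspace ?V" using Wsub by (rule subspace_inter[OF subspace_span])
    then obtain m where m: "?V \<subseteq> W m"
      using finite_span_chain[of "fst ` set_mset (\<Delta> x)" ?V W] left_submodule_subspace[OF W] incW
      by auto
    have disj_m: "y = 0" if "y \<in> Q" "p m y = y" for y using disj that by (auto simp: P_def)
    obtain r where r: "left_endomorphism r" "\<And>x. p m (r x) = r x"
      "\<And>x. p m x = x \<Longrightarrow> r x = x" "\<And>x. x \<in> Q \<Longrightarrow> r x = 0"
      using summand_projection_along[OF p(1)[of m] p(2)[of m] Q(1) disj_m] by blast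
    note rD = left_endomorphismD[OF r(1)]
    define x' where "x' = x - r x"
    define Q' where "Q' = {q + n | q n. q \<in> Q \<and> n \<in> {left_action h x' | h. h \<in> dual}}"
    have mem: "q + left_action h x' \<in> Q'" if "q \<in> Q" "h \<in> dual" for q h
      using that unfolding Q'_def by blast
    have "left_submodule Q'"
      unfolding Q'_def by (rule left_submodule_sum[OF Q(1) left_submodule_cyclic])
    moreover have "Q' \<inter> (P - {0}) = {}"
    proof -
      have "y = 0" if "y \<in> Q'" "y \<in> P" for y
      proof -
        obtain q h where y: "y = q + left_action h x'" "q \<in> Q" "h \<in> dual"
          using \<open>y \<in> Q'\<close> unfolding Q'_def by blast
        define z where "z = left_action h x"
        have y': "y = q + z - r z" using y by (simp add: x'_def z_def left_action_linear rD)
        have PW: "a \<in> (\<Union>n. W n)" if "a \<in> P" for a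
          using that subspace_0[OF subsp] unfolding P_def W_def by force
        have "q \<in> (\<Union>n. W n)"
          using y(2) left_endomorphismD(4)[OF p(1)] unfolding W_def by force
        moreover have "y \<in> (\<Union>n. W n)" using PW \<open>y \<in> P\<close> .
        moreover have "r z \<in> (\<Union>n. W n)" using PW r(2) by (auto simp: P_def)
        ultimately have "y + r z - q \<in> (\<Union>n. W n)"
          by (intro subspace_diff[OF Wsub] subspace_add[OF Wsub])
        then have "z \<in> (\<Union>n. W n)" by (simp add: y')
        then have "z \<in> W m" using m left_action_in_span[of h x] by (auto simp: z_def)
        then obtain a b where ab: "z = a + b" "p m a = a" "b \<in> Q" by (auto simp: W_def)
        then have "y = q + b" by (simp add: y' rD r)
        then have "y \<in> Q" using y(2) ab(3) subspace_add[OF subsp] by simp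
        then show "y = 0" using disj \<open>y \<in> P\<close> by blast
      qed
      then show ?thesis by blast
    qed
    moreover have "Q \<subseteq> Q'" using mem[OF _ zero_dual] by (auto simp: left_action_zero)
    ultimately have "Q' = Q" by (rule max)
    moreover have "x' \<in> Q'"
      using mem[OF subspace_0[OF subsp] counit_dual] by (simp add: left_action_counit)
    moreover have "r x \<in> P" using r(2) by (auto simp: P_def)
    ultimately show ?thesis unfolding x'_def by blast
  qed
  then show ?thesis using that[of Q] Q(1) disj by blast
qed

section \<open>A Cantor-Bernstein theorem for direct summands\<close>

text \<open>
  Extending \<open>\<epsilon> \<circ> f\<^sup>-\<^sup>1\<close> from the image of \<open>f\<close> to a functional \<open>\<mu>\<close> on \<open>C\<close> gives the left inverse
  \<open>y \<mapsto> y \<cdot> \<mu>\<close>. This is an instance of the injectivity of the comodule \<open>C\<close>.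
\<close>

lemma injective_endomorphism_left_inverse:
  assumes f: "left_endomorphism f" "inj f"
  obtains g where "left_endomorphism g" "\<And>x. g (f x) = x"
proof -
  interpret vp: vector_space_pair scale scale ..
  note fD = left_endomorphismD[OF f(1)]
  have "Vector_Spaces.linear scale scale f" by unfold_locales (simp_all add: fD)
  from vp.linear_injective_left_inverse[OF this f(2)]
  obtain t where t: "Vector_Spaces.linear scale scale t" "t \<circ> f = id" by blast
  interpret t: Vector_Spaces.linear scale scale t by fact
  let ?\<mu> = "\<lambda>x. \<epsilon> (t x)"
  have \<mu>: "?\<mu> \<in> dual" by (rule dual_linear_comp) (simp_all add: counit_dual t.add t.scale)
  have tf: "t (f x) = x" for x using t(2) by (simp add: fun_eq_iff)
  have "right_action (f x) ?\<mu> = x" for x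
    by (rule dual_separates)
      (simp add: right_action_functional[OF \<mu>] fD(2)[symmetric] tf left_action_pairing
        counit_dual convolution_counit)
  then show ?thesis using that right_action_endomorphism[OF \<mu>] by blast
qed

text \<open>
  Write \<open>X = ker e\<close>, so that \<open>C = X \<oplus> e(C)\<close>. The map \<open>p\<^sub>n\<close> in the proof is a projection onto
  \<open>P\<^sub>n = X \<oplus> f(X) \<oplus> \<dots> \<oplus> f\<^sup>n(X)\<close>; the recursion reflects \<open>P\<^sub>n\<^sub>+\<^sub>1 = X \<oplus> f(P\<^sub>n)\<close>: the map
  \<open>1 - e\<close> projects onto \<open>X\<close>, and \<open>f \<circ> p\<^sub>n \<circ> g\<close> projects \<open>e(C)\<close> onto \<open>f(P\<^sub>n)\<close> for a left inverse \<open>g\<close> of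
  \<open>f\<close>. Let \<open>Q\<close> be a complement of the union \<open>P\<close>. From
  \<open>P = X \<oplus> f(P)\<close> it follows that both \<open>C = X \<oplus> f(P) \<oplus> Q\<close> and \<open>C = X \<oplus> e(C)\<close>, so \<open>e\<close> maps \<open>f(P) \<oplus> Q\<close>
  isomorphically to \<open>e(C)\<close>, while \<open>f\<close> on \<open>P\<close> together with the identity on \<open>Q\<close> maps \<open>C = P \<oplus> Q\<close>
  isomorphically to \<open>f(P) \<oplus> Q\<close>.
\<close>

lemma summand_iso_if_embeds:
  assumes e: "left_endomorphism e" and ee: "\<And>x. e (e x) = e x"
    and f_endo: "left_endomorphism f" and f_inj: "inj f" and ef: "\<And>x. e (f x) = f x"
  obtains \<theta> where "left_endomorphism \<theta>" "inj \<theta>" "range \<theta> = range e"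
proof -
  note eD = left_endomorphismD[OF e] and fD = left_endomorphismD[OF f_endo]
  obtain g where g: "left_endomorphism g" "\<And>x. g (f x) = x"
    using injective_endomorphism_left_inverse[OF f_endo f_inj] by blast
  note gD = left_endomorphismD[OF g(1)]
  define p where "p = rec_nat (\<lambda>x. x - e x) (\<lambda>_ q x. x - e x + f (q (g (e x))))"
  have p_0: "p 0 x = x - e x" and p_Suc: "p (Suc n) x = x - e x + f (p n (g (e x)))" for n x
    by (simp_all add: p_def)
  have p_endo: "left_endomorphism (p n)" for n
  proof (induction n)
    case 0
    show ?case
      by (simp add: left_endomorphism_def p_0 eD left_action_linear algebra_simps)
  next
    case (Suc n)
    show ?case
      by (simp add: left_endomorphism_def p_Suc left_endomorphismD[OF Suc] eD fD gD
          left_action_linear algebra_simps)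
  qed
  have p_idem: "p n (p n x) = p n x" for n x
    by (induction n arbitrary: x) (simp_all add: p_0 p_Suc eD ee ef g(2))
  have p_X: "p n x = x" if "e x = 0" for n x
    using that by (cases n) (simp_all add: p_0 p_Suc gD fD left_endomorphismD(4)[OF p_endo])
  have p_f: "p (Suc n) (f x) = f x" if "p n x = x" for n x
    using that by (simp add: p_Suc ef g(2))
  have p_inc: "p (Suc n) x = x" if "p n x = x" for n x
    using that
  proof (induction n arbitrary: x)
    case 0
    then show ?case by (simp add: p_X p_0)
  next
    case (Suc n)
    define d where "d = p n (g (e x))"
    have x: "x = (x - e x) + f d" using Suc.prems by (simp add: p_Suc d_def)
    have "p (Suc n) d = d" unfolding d_def by (rule Suc.IH) (rule p_idem)
    then have "p (Suc (Suc n)) (f d) = f d" by (rule p_f)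
    moreover have "p (Suc (Suc n)) (x - e x) = x - e x" by (rule p_X) (simp add: eD ee)
    ultimately show ?case using x left_endomorphismD(1)[OF p_endo] by metis
  qed
  define P where "P = (\<Union>n. {a. p n a = a})"
  obtain Q where Q: "left_submodule Q" "Q \<inter> P \<subseteq> {0}" "\<And>x. \<exists>a\<in>P. x - a \<in> Q"
    using increasing_summands_complement[of p, OF p_endo p_idem p_inc] unfolding P_def by blast
  note Qsub = left_submodule_subspace[OF Q(1)]
  have p_mono: "p j a = a" if "p i a = a" "i \<le> j" for i j a
    using lift_Suc_mono_le[of "\<lambda>n. {a. p n a = a}", OF _ that(2)] p_inc that(1) by blast
  have P: "left_submodule P" unfolding P_def
  proof (rule left_submodule_chain_Union)
    fix U V assume "U \<in> range (\<lambda>n. {a. p n a = a})" "V \<in> range (\<lambda>n. {a. p n a = a})"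
    then obtain i j where "U = {a. p i a = a}" "V = {a. p j a = a}" by blast
    then show "U \<subseteq> V \<or> V \<subseteq> U" using p_mono by (cases "i \<le> j") auto
  qed (use left_submodule_fixed[OF p_endo] in auto)
  note Psub = left_submodule_subspace[OF P]
  have PQ: "x = 0" if "x \<in> P" "x \<in> Q" for x using Q(2) that by blast
  obtain \<pi> where \<pi>: "\<And>x. \<pi> x \<in> P" "\<And>x. x - \<pi> x \<in> Q"
    using Q(3) by metis
  have \<pi>_eq: "\<pi> x = a" if "a \<in> P" "x - a \<in> Q" for x a
    using PQ[OF subspace_diff[OF Psub \<pi>(1)[of x] that(1)]] subspace_diff[OF Qsub that(2) \<pi>(2)[of x]]
    by (simp add: algebra_simps)
  have \<pi>_endo: "left_endomorphism \<pi>" unfolding left_endomorphism_def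
  proof (intro conjI allI ballI)
    fix x y
    show "\<pi> (x + y) = \<pi> x + \<pi> y"
      using subspace_add[OF Qsub \<pi>(2)[of x] \<pi>(2)[of y]] subspace_add[OF Psub \<pi>(1) \<pi>(1)]
      by (intro \<pi>_eq) (simp_all add: algebra_simps)
  next
    fix h x assume "h \<in> dual"
    then show "\<pi> (left_action h x) = left_action h (\<pi> x)"
      using P Q(1) \<pi>[of x]
      by (intro \<pi>_eq) (simp_all add: left_submodule_def left_action_linear(2)[symmetric])
  qed
  note \<pi>D = left_endomorphismD[OF \<pi>_endo]
  define \<eta> where "\<eta> y = f (\<pi> y) + (y - \<pi> y)" for y
  have \<eta>_endo: "left_endomorphism \<eta>"
    by (simp add: left_endomorphism_def \<eta>_def \<pi>D fD left_action_linear algebra_simps)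
  note \<eta>D = left_endomorphismD[OF \<eta>_endo]
  have "left_endomorphism (\<lambda>y. e (\<eta> y))" by (simp add: left_endomorphism_def eD \<eta>D)
  moreover have "inj (\<lambda>y. e (\<eta> y))"
  proof -
    have ker: "y = 0" if e0: "e (\<eta> y) = 0" for y
    proof -
      have "\<eta> y \<in> P" using e0 p_X by (auto simp: P_def)
      moreover have "f (\<pi> y) \<in> P" using \<pi>(1)[of y] p_f by (auto simp: P_def)
      ultimately have "y - \<pi> y \<in> P"
        using subspace_diff[OF Psub, of "\<eta> y" "f (\<pi> y)"] by (simp add: \<eta>_def)
      then have y: "y - \<pi> y = 0" using PQ \<pi>(2) by blast
      then have "f (\<pi> y) = 0" using e0 by (simp add: \<eta>_def ef)
      then have "\<pi> y = 0" using f_inj fD(4) by (metis injD)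
      then show "y = 0" using y by simp
    qed
    show ?thesis
    proof (rule injI)
      fix y z assume "e (\<eta> y) = e (\<eta> z)"
      then have "e (\<eta> (y - z)) = 0" by (simp add: \<eta>D eD)
      then have "y - z = 0" by (rule ker)
      then show "y = z" by simp
    qed
  qed
  moreover have "\<exists>z. e y = e (\<eta> z)" for y
  proof -
    \<comment> \<open>The \<open>P\<close>-component of \<open>y\<close> lies in \<open>X + f(P)\<close>, so its image under \<open>e\<close> lies in \<open>f(P)\<close>.\<close>
    obtain n where n: "p n (\<pi> y) = \<pi> y" using \<pi>(1) by (auto simp: P_def)
    obtain b where b: "b \<in> P" "e (\<pi> y) = f b"
    proof (cases n)
      case 0
      then have "e (\<pi> y) = 0" using n by (simp add: p_0)
      then show ?thesis using that[of 0] subspace_0[OF Psub] fD(4) by simp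
    next
      case (Suc m)
      then have "e (\<pi> y) = f (p m (g (e (\<pi> y))))" using n by (simp add: p_Suc)
      then show ?thesis using that p_idem by (force simp: P_def)
    qed
    define z where "z = b + (y - \<pi> y)"
    have "\<pi> z = b" by (rule \<pi>_eq) (simp_all add: z_def b \<pi>)
    then have "\<eta> z = e (\<pi> y) + (y - \<pi> y)" by (simp add: \<eta>_def z_def b)
    then have "e (\<eta> z) = e y" by (simp add: eD ee)
    then show ?thesis by metis
  qed
  then have "range (\<lambda>y. e (\<eta> y)) = range e" by blast
  ultimately show ?thesis by (rule that)
qed

section \<open>Module maps into the dual\<close>

lemma left_dual_module_homD:
  assumes "left_dual_module_hom \<phi>"
  shows "\<phi> x \<in> dual" "\<phi> (x + y) = \<phi> x + \<phi> y"
    "f \<in> dual \<Longrightarrow> \<phi> (left_action f x) = convolution f (\<phi> x)"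
    "\<phi> (a *s x) = fun_scale a (\<phi> x)"
proof -
  show 1: "\<phi> x \<in> dual" "\<phi> (x + y) = \<phi> x + \<phi> y"
    and 2: "f \<in> dual \<Longrightarrow> \<phi> (left_action f x) = convolution f (\<phi> x)" for f
    using assms by (auto simp: left_dual_module_hom_def)
  show "\<phi> (a *s x) = fun_scale a (\<phi> x)"
    using 2[OF scaled_counit_dual] by (simp add: left_action_scaled_counit convolution_scaled_counit 1)
qed

lemma right_dual_module_homD:
  assumes "right_dual_module_hom \<psi>"
  shows "\<psi> x \<in> dual" "\<psi> (x + y) = \<psi> x + \<psi> y"
    "f \<in> dual \<Longrightarrow> \<psi> (right_action x f) = convolution (\<psi> x) f"
    "\<psi> (a *s x) = fun_scale a (\<psi> x)"
proof -
  show 1: "\<psi> x \<in> dual" "\<psi> (x + y) = \<psi> x + \<psi> y"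
    and 2: "f \<in> dual \<Longrightarrow> \<psi> (right_action x f) = convolution (\<psi> x) f" for f
    using assms by (auto simp: right_dual_module_hom_def)
  have "right_action x (\<lambda>x. a * \<epsilon> x) = a *s x"
    by (rule dual_separates)
      (simp add: right_action_pairing convolution_scaled_counit dualD fun_scale_def)
  moreover have "convolution (\<psi> x) (\<lambda>x. a * \<epsilon> x) = fun_scale a (\<psi> x)"
  proof
    fix y
    have "convolution (\<psi> x) (\<lambda>x. a * \<epsilon> x) y = \<psi> x (left_action (\<lambda>x. a * \<epsilon> x) y)"
      by (simp add: left_action_pairing 1)
    then show "convolution (\<psi> x) (\<lambda>x. a * \<epsilon> x) y = fun_scale a (\<psi> x) y"
      by (simp add: left_action_scaled_counit dualD[OF 1(1)] fun_scale_def)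
  qed
  ultimately show "\<psi> (a *s x) = fun_scale a (\<psi> x)"
    using 2[OF scaled_counit_dual[of a]] by simp
qed

text \<open>
  Both kinds of module maps are balanced bilinear forms \<open>\<psi>(x)(y)\<close>, read with one or the other argument
  fixed.
\<close>

lemma transpose_left_dual_module_hom:
  assumes "right_dual_module_hom \<psi>"
  shows "left_dual_module_hom (\<lambda>y x. \<psi> x y)"
proof -
  note D = right_dual_module_homD[OF assms]
  have dual: "(\<lambda>x. \<psi> x y) \<in> dual" for y
    by (rule dualI) (simp_all add: D fun_scale_def)
  have "\<psi> x (left_action f y) = convolution f (\<lambda>x. \<psi> x y) x" if "f \<in> dual" for f x y
    using D(3)[OF that, of x] right_action_pairing[OF dual[of y], of x f]
    by (simp add: left_action_pairing D(1))
  then show ?thesis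
    by (auto simp: left_dual_module_hom_def dual dualD[OF D(1)] fun_eq_iff)
qed

section \<open>Non-degenerate balanced forms\<close>

lemma nondegenerate_balanced_imp_co_frobenius:
  assumes "bilinear_form B" "nondegenerate B" "balanced B"
  shows co_frobenius
proof -
  have dual: "B x \<in> dual" "(\<lambda>x. B x y) \<in> dual" for x y
    using assms(1) by (auto simp: bilinear_form_def dual_def)
  have bal: "B (right_action x f) y = B x (left_action f y)" if "f \<in> dual" for x y f
    using assms(3) that by (simp add: balanced_def)
  have "left_dual_module_hom (\<lambda>y x. B x y)"
    using bal right_action_pairing[OF dual(2)]
    by (auto simp: left_dual_module_hom_def dual dualD[OF dual(1)] fun_eq_iff)
  moreover have "inj (\<lambda>y x. B x y)"
  proof (rule injI)
    fix y z assume "(\<lambda>x. B x y) = (\<lambda>x. B x z)"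
    then have "B x (y - z) = 0" for x by (simp add: dualD[OF dual(1)] fun_eq_iff)
    then show "y = z" using assms(2) by (force simp: nondegenerate_def)
  qed
  moreover have "right_dual_module_hom B"
    using bal left_action_pairing[OF dual(1)]
    by (auto simp: right_dual_module_hom_def dual dualD[OF dual(2)] fun_eq_iff)
  moreover have "inj B"
  proof (rule injI)
    fix y z assume "B y = B z"
    then have "B (y - z) x = 0" for x by (simp add: dualD[OF dual(2)])
    then show "y = z" using assms(2) by (force simp: nondegenerate_def)
  qed
  ultimately show ?thesis
    unfolding co_frobenius_def left_co_frobenius_def right_co_frobenius_def by blast
qed

text \<open>
  The form \<open>\<psi>(x)(y)\<close> may degenerate in \<open>y\<close>; its kernel there is the kernel \<open>X\<close> of \<open>e\<close>, and \<open>e(C)\<close> is a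
  complement of \<open>X\<close>. Replacing \<open>y\<close> by \<open>\<theta>(y)\<close>, where \<open>\<theta>\<close> is an isomorphism \<open>C \<rightarrow> e(C)\<close>, removes the kernel
  without losing any of the functionals \<open>\<psi>(-)(y)\<close>. The injective left module map \<open>\<phi>\<close> embeds
  \<open>C\<close> into \<open>e(C)\<close>, from which \<open>\<theta>\<close> is obtained.
\<close>

lemma co_frobenius_imp_nondegenerate_balanced:
  assumes co_frobenius
  shows "\<exists>B. bilinear_form B \<and> nondegenerate B \<and> balanced B"
proof -
  obtain \<phi> where \<phi>: "left_dual_module_hom \<phi>" "inj \<phi>"
    using assms by (auto simp: co_frobenius_def left_co_frobenius_def)
  obtain \<psi> where \<psi>: "right_dual_module_hom \<psi>" "inj \<psi>"
    using assms by (auto simp: co_frobenius_def right_co_frobenius_def)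
  note \<psi>D = right_dual_module_homD[OF \<psi>(1)]
  define \<psi>' where "\<psi>' y x = \<psi> x y" for y x
  have \<psi>': "left_dual_module_hom \<psi>'"
    using transpose_left_dual_module_hom[OF \<psi>(1)] by (simp add: \<psi>'_def[abs_def])
  interpret dv: vector_space "fun_scale :: 'k \<Rightarrow> ('c \<Rightarrow> 'k) \<Rightarrow> 'c \<Rightarrow> 'k"
    by (rule vector_space_fun_scale)
  interpret vp: vector_space_pair scale "fun_scale :: 'k \<Rightarrow> ('c \<Rightarrow> 'k) \<Rightarrow> 'c \<Rightarrow> 'k" ..
  have "Vector_Spaces.linear scale fun_scale \<psi>" by unfold_locales (simp_all add: \<psi>D)
  from vp.linear_injective_left_inverse[OF this \<psi>(2)]
  obtain t where t: "Vector_Spaces.linear fun_scale scale t" "t \<circ> \<psi> = id" by blast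
  interpret t: Vector_Spaces.linear fun_scale scale t by fact
  define \<Lambda> where "\<Lambda> F = \<epsilon> (t F)" for F
  have \<Lambda>\<psi>: "\<Lambda> (\<psi> x) = \<epsilon> x" for x using t(2) by (simp add: \<Lambda>_def fun_eq_iff)
  have \<Lambda>_dual: "(\<lambda>x. \<Lambda> (\<chi> x)) \<in> dual" if "left_dual_module_hom \<chi>" for \<chi>
    unfolding \<Lambda>_def
    by (rule dualI)
      (simp_all add: left_dual_module_homD[OF that] t.add t.scale dualD[OF counit_dual])
  \<comment> \<open>The map \<open>s \<chi>\<close> is the lift of \<open>\<chi>\<close> through \<open>\<psi>'\<close>.\<close>
  define s where "s \<chi> y = right_action y (\<lambda>x. \<Lambda> (\<chi> x))" for \<chi> y
  have s_pairing: "h (s \<chi> y) = \<Lambda> (convolution h (\<chi> y))"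
    if "left_dual_module_hom \<chi>" "h \<in> dual" for \<chi> h y
    by (simp add: s_def right_action_functional \<Lambda>_dual left_dual_module_homD that)
  have s_endo: "left_endomorphism (s \<chi>)" if "left_dual_module_hom \<chi>" for \<chi>
    using right_action_endomorphism[OF \<Lambda>_dual[OF that]] by (simp add: s_def[abs_def])
  have \<psi>'s: "\<psi>' (s \<chi> y) = \<chi> y" if "left_dual_module_hom \<chi>" for \<chi> y
  proof
    fix x
    have "\<psi> x (s \<chi> y) = \<Lambda> (\<psi> (right_action x (\<chi> y)))"
      by (simp add: s_pairing that \<psi>D left_dual_module_homD[OF that])
    also have "\<dots> = \<chi> y x"
      by (simp add: \<Lambda>\<psi> right_action_pairing counit_dual convolution_counit
          left_dual_module_homD[OF that])
    finally show "\<psi>' (s \<chi> y) x = \<chi> y x" by (simp add: \<psi>'_def)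
  qed
  define f where "f = s \<phi>"
  define e where "e = s \<psi>'"
  note eD = left_endomorphismD[OF s_endo[OF \<psi>'], folded e_def]
  have \<psi>'f: "\<psi>' (f y) = \<phi> y" and \<psi>'e: "\<psi>' (e y) = \<psi>' y" for y
    by (simp_all add: f_def e_def \<psi>'s \<phi> \<psi>')
  \<comment> \<open>By \<open>s_pairing\<close>, the lift \<open>s \<chi> y\<close> depends on \<open>y\<close> only through the functional \<open>\<chi> y\<close>.\<close>
  have e_cong: "e y = e z" if "\<psi>' y = \<psi>' z" for y z
    by (rule dual_separates) (simp add: e_def s_pairing \<psi>' that)
  have ee: "e (e y) = e y" for y by (rule e_cong) (rule \<psi>'e)
  have ef: "e (f y) = f y" for y
    by (rule dual_separates) (simp add: e_def s_pairing \<psi>' \<psi>'f, simp add: f_def s_pairing \<phi>)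
  have \<psi>'0: "\<psi>' 0 = 0" using left_dual_module_homD(2)[OF \<psi>', of 0 0] by simp
  have ker_e: "e y = 0" if "\<psi>' y = 0" for y
    using e_cong[of y 0] that \<psi>'0 by (simp add: eD)
  have "inj f" using \<psi>'f \<phi>(2) by (metis injI injD)
  moreover have "left_endomorphism f" "left_endomorphism e"
    using s_endo \<phi> \<psi>' by (simp_all add: f_def e_def)
  ultimately obtain \<theta> where \<theta>: "left_endomorphism \<theta>" "inj \<theta>" "range \<theta> = range e"
    using summand_iso_if_embeds[of e f] ee ef by blast
  define B where "B x y = \<psi> x (\<theta> y)" for x y
  have "bilinear_form B"
  proof -
    have "B x \<in> dual" for x unfolding B_def[abs_def]
      by (rule dual_linear_comp) (simp_all add: \<psi>D left_endomorphismD[OF \<theta>(1)])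
    moreover have "(\<lambda>x. B x y) \<in> dual" for y
      using left_dual_module_homD(1)[OF \<psi>', of "\<theta> y"] by (simp add: B_def \<psi>'_def[abs_def])
    ultimately show ?thesis by (simp add: bilinear_form_def dual_def)
  qed
  moreover have "balanced B"
    by (simp add: balanced_def B_def \<psi>D left_endomorphismD(2)[OF \<theta>(1)] left_action_pairing)
  moreover have "nondegenerate B" unfolding nondegenerate_def
  proof (intro conjI allI impI)
    fix y assume "\<forall>x. B x y = 0"
    then have "\<psi>' (\<theta> y) = 0" by (simp add: B_def \<psi>'_def fun_eq_iff)
    then have "e (\<theta> y) = 0" by (rule ker_e)
    moreover have "e (\<theta> y) = \<theta> y" using \<theta>(3) ee by (metis rangeE rangeI)
    ultimately show "y = 0" using \<theta>(2) left_endomorphismD(4)[OF \<theta>(1)] by (metis injD)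
  next
    fix x assume B0: "\<forall>y. B x y = 0"
    have "\<psi> x y = 0" for y
    proof -
      obtain z where "e y = \<theta> z" using \<theta>(3) by (metis rangeE rangeI)
      then have "\<psi> x (e y) = 0" using B0 by (simp add: B_def)
      then show ?thesis using \<psi>'e[of y] by (simp add: \<psi>'_def fun_eq_iff)
    qed
    moreover have "\<psi> 0 = 0" using \<psi>D(2)[of 0 0] by simp
    ultimately have "\<psi> x = \<psi> 0" by (simp add: fun_eq_iff)
    then show "x = 0" using \<psi>(2) by (simp add: injD)
  qed
  ultimately show ?thesis by blast
qed

end

theorem proposition2p6:
  fixes scale :: "'k::field \<Rightarrow> 'c::ab_group_add \<Rightarrow> 'c"
    and \<Delta> :: "'c \<Rightarrow> ('c \<times> 'c) multiset"
    and \<epsilon> :: "'c \<Rightarrow> 'k"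
  assumes "coalgebra scale \<Delta> \<epsilon>"
    and "coalgebra.semiperfect scale \<Delta> \<epsilon> TYPE('u)"
  shows "coalgebra.co_frobenius scale \<Delta> \<longleftrightarrow>
    (\<exists>B. coalgebra.bilinear_form scale B \<and> coalgebra.nondegenerate B \<and> coalgebra.balanced scale \<Delta> B)"
proof -
  interpret coalgebra scale \<Delta> \<epsilon> by fact
  show ?thesis
    using nondegenerate_balanced_imp_co_frobenius co_frobenius_imp_nondegenerate_balanced by blast
qed

end
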